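(* For any argument filtering function $\pi$ and any term $t\in\mathcal T$, $\pi(t)$ is well-typed under the typing function $type_\pi$, and $type_\pi(\pi(t))=type(t)$.
   Context: Setting: HRSs à la Nipkow. Simple types are generated from a set $\mathcal B$ of basic types by $\to$. $\mathcal T$ is the set of simply-typed $\lambda$-terms over typed variables $\mathcal V$ and typed function symbols $\Sigma$ in $\beta$-normal $\eta$-long form; every term has the form $\lambda x_1\ldots x_m.a(t_1,\ldots,t_n)$ with $a\in\Sigma\cup\mathcal V$; $type$ gives the type of symbols and terms. An argument filtering function $\pi$ assigns to every $f\in\Sigma$ of type $\alpha_1\to\cdots\to\alpha_n\to\beta$ with $\beta\in\mathcal B$ either a positive integer $i\le n$ such that $\alpha_i=\beta$, or a list $[i_1,\ldots,i_k]$ of positive integers with $i_1,\ldots,i_k\le n$. It is extended to terms by: $\pi(\lambda x_1\ldots x_m.a(t_1,\ldots,t_n))\equiv\lambda x_1\ldots x_m.\pi(t_i)$ if $a\in\Sigma$ and $\pi(a)=i$; $\equiv\lambda x_1\ldots x_m.a(\pi(t_{i_1}),\ldots,\pi(t_{i_k}))$ if $a\in\Sigma$ and $\pi(a)=[i_1,\ldots,i_k]$; $\equiv\lambda x_1\ldots x_m.a(\pi(t_1),\ldots,\pi(t_n))$ if $a\in\mathcal V$. The typing function after filtering is $type_\pi(a)=\alpha_{i_1}\to\cdots\to\alpha_{i_k}\to\beta$ if $a\in\Sigma$, $\pi(a)=[i_1,\ldots,i_k]$ and $type(a)=\alpha_1\to\cdots\to\alpha_n\to\beta$ with $\beta\in\mathcal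 B$; otherwise $type_\pi(a)=type(a)$. *)

theory Defs
  imports Main
begin

datatype 'b ty =
    Base 'b
  | Arrow "'b ty" "'b ty"  (infixr "\<rightarrow>" 60)

text \<open>
  Every simple type is uniquely \<open>\<alpha>\<^sub>1 \<rightarrow> \<dots> \<rightarrow> \<alpha>\<^sub>n \<rightarrow> Base b\<close>;
  \<open>arg_types\<close> gives \<open>[\<alpha>\<^sub>1, \<dots>, \<alpha>\<^sub>n]\<close> and \<open>result_base\<close> gives \<open>b\<close>.
\<close>

primrec arg_types :: "'b ty \<Rightarrow> 'b ty list" where
  "arg_types (Base b) = []"
| "arg_types (\<alpha> \<rightarrow> \<beta>) = \<alpha> # arg_types \<beta>"

primrec result_base :: "'b ty \<Rightarrow> 'b" where
  "result_base (Base b) = b"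
| "result_base (\<alpha> \<rightarrow> \<beta>) = result_base \<beta>"

definition arrows :: "'b ty list \<Rightarrow> 'b ty \<Rightarrow> 'b ty" where
  "arrows \<alpha>s \<beta> = foldr (\<rightarrow>) \<alpha>s \<beta>"

lemma arrows_arg_types: "arrows (arg_types \<sigma>) (Base (result_base \<sigma>)) = \<sigma>"
  by (induction \<sigma>) (auto simp: arrows_def)

text \<open>
  Function symbols and variables are kept apart by \<open>atom\<close>.  A typing function assigns a type
  to every atom, so variables carry a fixed type, no typing context is needed, and a bound
  variable has the type the typing function gives it.  Bound variables are named; the terms
  below are representatives of \<open>\<alpha>\<close>-equivalence classes.
\<close>

datatype ('f, 'v) atom = Sym 'f | Var 'v

datatype ('f, 'v) trm =
    Atom "('f, 'v) atom"
  | App "('f, 'v) trm" "('f, 'v) trm"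
  | Lam 'v "('f, 'v) trm"

type_synonym ('f, 'v, 'b) typing = "('f, 'v) atom \<Rightarrow> 'b ty"

text \<open>Extension of a typing function to terms; \<open>None\<close> means not typable.\<close>

primrec type_of :: "('f, 'v, 'b) typing \<Rightarrow> ('f, 'v) trm \<Rightarrow> 'b ty option" where
  "type_of \<tau> (Atom a) = Some (\<tau> a)"
| "type_of \<tau> (App s t) =
     (case type_of \<tau> s of
        Some (\<alpha> \<rightarrow> \<beta>) \<Rightarrow> if type_of \<tau> t = Some \<alpha> then Some \<beta> else None
      | _ \<Rightarrow> None)"
| "type_of \<tau> (Lam x s) =
     (case type_of \<tau> s of Some \<beta> \<Rightarrow> Some (\<tau> (Var x) \<rightarrow> \<beta>) | None \<Rightarrow> None)"

definition well_typed :: "('f, 'v, 'b) typing \<Rightarrow> ('f, 'v) trm \<Rightarrow> bool" where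
  "well_typed \<tau> t \<longleftrightarrow> type_of \<tau> t \<noteq> None"

definition is_abs :: "('f, 'v) trm \<Rightarrow> bool" where
  "is_abs t \<longleftrightarrow> (\<exists>x s. t = Lam x s)"

primrec beta_normal :: "('f, 'v) trm \<Rightarrow> bool" where
  "beta_normal (Atom a) \<longleftrightarrow> True"
| "beta_normal (App s t) \<longleftrightarrow> \<not> is_abs s \<and> beta_normal s \<and> beta_normal t"
| "beta_normal (Lam x s) \<longleftrightarrow> beta_normal s"

text \<open>
  The proper subterms of a term that do not occur in function position: these, and the term
  itself, are the ones that \<open>\<eta>\<close>-expansion could apply to without creating a \<open>\<beta>\<close>-redex.
\<close>

primrec nonfun_subterms :: "('f, 'v) trm \<Rightarrow> ('f, 'v) trm set" where
  "nonfun_subterms (Atom a) = {}"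
| "nonfun_subterms (App s t) = nonfun_subterms s \<union> insert t (nonfun_subterms t)"
| "nonfun_subterms (Lam x s) = insert s (nonfun_subterms s)"

definition eta_long :: "('f, 'v, 'b) typing \<Rightarrow> ('f, 'v) trm \<Rightarrow> bool" where
  "eta_long \<tau> t \<longleftrightarrow>
     (\<forall>s \<in> insert t (nonfun_subterms t). is_abs s \<or> (\<exists>b. type_of \<tau> s = Some (Base b)))"

text \<open>The set \<open>\<T>\<close> of simply-typed terms in \<open>\<beta>\<close>-normal \<open>\<eta>\<close>-long form.\<close>

definition terms :: "('f, 'v, 'b) typing \<Rightarrow> ('f, 'v) trm set" where
  "terms \<tau> = {t. well_typed \<tau> t \<and> beta_normal t \<and> eta_long \<tau> t}"

text \<open>\<open>lams [x\<^sub>1, \<dots>, x\<^sub>m] (apps (Atom a) [t\<^sub>1, \<dots>, t\<^sub>n])\<close> is \<open>\<lambda>x\<^sub>1 \<dots> x\<^sub>m. a(t\<^sub>1, \<dots>, t\<^sub>n)\<close>.\<close>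

definition lams :: "'v list \<Rightarrow> ('f, 'v) trm \<Rightarrow> ('f, 'v) trm" where
  "lams xs t = foldr Lam xs t"

definition apps :: "('f, 'v) trm \<Rightarrow> ('f, 'v) trm list \<Rightarrow> ('f, 'v) trm" where
  "apps t ts = foldl App t ts"

fun head :: "('f, 'v) trm \<Rightarrow> ('f, 'v) trm" where
  "head (App s t) = head s"
| "head t = t"

fun args :: "('f, 'v) trm \<Rightarrow> ('f, 'v) trm list" where
  "args (App s t) = args s @ [t]"
| "args t = []"

lemma apps_head_args: "apps (head t) (args t) = t"
  by (induction t) (auto simp: apps_def)

lemma head_apps [simp]: "head (apps t ts) = head t"
  by (induction ts arbitrary: t) (auto simp: apps_def)

lemma args_apps [simp]: "args (apps t ts) = args t @ ts"
  by (induction ts arbitrary: t) (auto simp: apps_def)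

lemma is_abs_apps_Atom [simp]: "\<not> is_abs (apps (Atom a) ts)"
  by (induction ts rule: rev_induct) (auto simp: apps_def is_abs_def)

lemma beta_normal_form:
  assumes "beta_normal t"
  shows "\<exists>xs a ts. t = lams xs (apps (Atom a) ts)"
proof -
  have app: "beta_normal s \<Longrightarrow> \<not> is_abs s \<Longrightarrow> \<exists>a ts. s = apps (Atom a) ts" for s :: "('a, 'b) trm"
  proof (induction s)
    case (Atom a)
    then show ?case by (metis apps_def foldl_Nil)
  next
    case (App s1 s2)
    then obtain a ts where "s1 = apps (Atom a) ts" by auto
    then have "App s1 s2 = apps (Atom a) (ts @ [s2])" by (simp add: apps_def)
    then show ?case by blast
  qed (simp add: is_abs_def)
  show ?thesis using assms
  proof (induction t)
    case (Lam x s)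
    then obtain xs a ts where "s = lams xs (apps (Atom a) ts)" by auto
    then have "Lam x s = lams (x # xs) (apps (Atom a) ts)" by (simp add: lams_def)
    then show ?case by blast
  qed (metis app foldr_Nil id_apply is_abs_def lams_def trm.distinct)+
qed

text \<open>
  Positions are counted from 1, so the \<open>i\<close>-th element of a list \<open>xs\<close> is \<open>xs ! (i - 1)\<close>.
  In a \<open>Select\<close> list, positions may be permuted, repeated or absent.
\<close>

datatype filter_spec = Collapse nat | Select "nat list"

definition arg_filtering :: "('f, 'v, 'b) typing \<Rightarrow> ('f \<Rightarrow> filter_spec) \<Rightarrow> bool" where
  "arg_filtering \<tau> \<pi> \<longleftrightarrow>
     (\<forall>f. let \<alpha>s = arg_types (\<tau> (Sym f)); \<beta> = Base (result_base (\<tau> (Sym f))) in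
        case \<pi> f of
          Collapse i \<Rightarrow> 1 \<le> i \<and> i \<le> length \<alpha>s \<and> \<alpha>s ! (i - 1) = \<beta>
        | Select is \<Rightarrow> (\<forall>i \<in> set is. 1 \<le> i \<and> i \<le> length \<alpha>s))"

fun filter_apps ::
  "('f \<Rightarrow> filter_spec) \<Rightarrow> ('f, 'v) atom \<Rightarrow> ('f, 'v) trm list \<Rightarrow> ('f, 'v) trm" where
  "filter_apps \<pi> (Sym f) us =
     (case \<pi> f of
        Collapse i \<Rightarrow> us ! (i - 1)
      | Select is \<Rightarrow> apps (Atom (Sym f)) (map (\<lambda>i. us ! (i - 1)) is))"
| "filter_apps \<pi> (Var x) us = apps (Atom (Var x)) us"

lemma size_args: "u \<in> set (args t) \<Longrightarrow> size u < size t"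
  by (induction t) auto

text \<open>
  The final default case arises only for terms with a \<open>\<beta>\<close>-redex at the head.
\<close>

function filter_trm :: "('f \<Rightarrow> filter_spec) \<Rightarrow> ('f, 'v) trm \<Rightarrow> ('f, 'v) trm" where
  "filter_trm \<pi> t =
     (case t of
        Lam x s \<Rightarrow> Lam x (filter_trm \<pi> s)
      | _ \<Rightarrow> (case head t of
                Atom a \<Rightarrow> filter_apps \<pi> a (map (filter_trm \<pi>) (args t))
              | _ \<Rightarrow> t))"
  by pat_completeness auto
termination
  by (relation "measure (\<lambda>(\<pi>, t). size t)") (auto dest: size_args)

declare filter_trm.simps [simp del]

text \<open>The three defining equations of the extension of \<open>\<pi>\<close> to terms.\<close>

lemma filter_trm_lams_apps:
  "filter_trm \<pi> (lams xs (apps (Atom a) ts)) =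
     lams xs (filter_apps \<pi> a (map (filter_trm \<pi>) ts))"
proof (induction xs)
  case Nil
  have "filter_trm \<pi> u = filter_apps \<pi> a (map (filter_trm \<pi>) (args u))"
    if "\<not> is_abs u" "head u = Atom a" for u
    using that by (subst filter_trm.simps) (cases u; simp add: is_abs_def)
  from this[of "apps (Atom a) ts"]
  have "filter_trm \<pi> (apps (Atom a) ts) = filter_apps \<pi> a (map (filter_trm \<pi>) ts)"
    by simp
  then show ?case by (simp add: lams_def)
next
  case (Cons x xs)
  then show ?case by (simp add: lams_def filter_trm.simps[of _ "Lam _ _"])
qed

lemma filter_trm_Collapse:
  assumes "\<pi> f = Collapse i" "1 \<le> i" "i \<le> length ts"
  shows "filter_trm \<pi> (lams xs (apps (Atom (Sym f)) ts)) = lams xs (filter_trm \<pi> (ts ! (i - 1)))"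
  using assms by (simp add: filter_trm_lams_apps)

lemma filter_trm_Select:
  assumes "\<pi> f = Select is" "\<forall>i \<in> set is. 1 \<le> i \<and> i \<le> length ts"
  shows "filter_trm \<pi> (lams xs (apps (Atom (Sym f)) ts)) =
           lams xs (apps (Atom (Sym f)) (map (\<lambda>i. filter_trm \<pi> (ts ! (i - 1))) is))"
proof -
  have "map (\<lambda>i. map (filter_trm \<pi>) ts ! (i - 1)) is = map (\<lambda>i. filter_trm \<pi> (ts ! (i - 1))) is"
    using assms(2) by (intro map_cong refl nth_map) fastforce
  then show ?thesis using assms(1) by (simp only: filter_trm_lams_apps filter_apps.simps filter_spec.case)
qed

lemma filter_trm_Var:
  "filter_trm \<pi> (lams xs (apps (Atom (Var x)) ts)) =
     lams xs (apps (Atom (Var x)) (map (filter_trm \<pi>) ts))"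
  by (simp add: filter_trm_lams_apps)

text \<open>The typing function \<open>type\<^sub>\<pi>\<close>.\<close>

fun filter_typing :: "('f, 'v, 'b) typing \<Rightarrow> ('f \<Rightarrow> filter_spec) \<Rightarrow> ('f, 'v, 'b) typing" where
  "filter_typing \<tau> \<pi> (Sym f) =
     (case \<pi> f of
        Collapse i \<Rightarrow> \<tau> (Sym f)
      | Select is \<Rightarrow>
          arrows (map (\<lambda>i. arg_types (\<tau> (Sym f)) ! (i - 1)) is) (Base (result_base (\<tau> (Sym f)))))"
| "filter_typing \<tau> \<pi> (Var x) = \<tau> (Var x)"

end

theory Submission imports Defs begin

text \<open>
  By induction on the size of \<open>t\<close>. An abstraction keeps its type because \<open>type\<^sub>\<pi>\<close> agrees with
  \<open>type\<close> on variables. Otherwise \<open>t = a(t\<^sub>1, \<dots>, t\<^sub>n)\<close>, and \<open>\<eta>\<close>-long form forces \<open>t\<close> to have base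
  type: \<open>a\<close> is applied to all the arguments its type admits, so every position in \<open>\<pi>(a)\<close> refers
  to an existing argument, and a collapsing filter selects an argument of the type of \<open>t\<close>.
\<close>

lemma arg_types_arrows [simp]: "arg_types (arrows \<alpha>s \<beta>) = \<alpha>s @ arg_types \<beta>"
  by (induction \<alpha>s) (auto simp: arrows_def)

lemma result_base_arrows [simp]: "result_base (arrows \<alpha>s \<beta>) = result_base \<beta>"
  by (induction \<alpha>s) (auto simp: arrows_def)

lemma type_of_App_eq_Some:
  "type_of \<tau> (App s t) = Some \<beta> \<longleftrightarrow>
     (\<exists>\<alpha>. type_of \<tau> s = Some (\<alpha> \<rightarrow> \<beta>) \<and> type_of \<tau> t = Some \<alpha>)"
  by (auto split: option.splits ty.splits)

text \<open>Used in both directions: to read off the argument types of a typed application, and to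
  type the filtered application from its head and its arguments.\<close>

lemma type_of_apps_eq_Some:
  "type_of \<tau> (apps s ts) = Some \<beta> \<longleftrightarrow>
     (\<exists>\<alpha>s. type_of \<tau> s = Some (arrows \<alpha>s \<beta>) \<and> map (type_of \<tau>) ts = map Some \<alpha>s)"
proof (induction ts arbitrary: s)
  case Nil
  then show ?case by (simp add: apps_def arrows_def)
next
  case (Cons t ts)
  have "type_of \<tau> (apps s (t # ts)) = Some \<beta> \<longleftrightarrow>
      (\<exists>\<alpha>s. type_of \<tau> (App s t) = Some (arrows \<alpha>s \<beta>) \<and> map (type_of \<tau>) ts = map Some \<alpha>s)"
    using Cons.IH[of "App s t"] by (simp add: apps_def)
  also have "\<dots> \<longleftrightarrow> (\<exists>\<alpha> \<alpha>s. type_of \<tau> s = Some (arrows (\<alpha> # \<alpha>s) \<beta>) \<and>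
      map (type_of \<tau>) (t # ts) = map Some (\<alpha> # \<alpha>s))"
    unfolding type_of_App_eq_Some by (auto simp: arrows_def)
  \<comment> \<open>The list on the left is nonempty, so any matching list of types has the form
    \<open>\<alpha> # \<alpha>s\<close>.\<close>
  also have "\<dots> \<longleftrightarrow> (\<exists>\<alpha>s. type_of \<tau> s = Some (arrows \<alpha>s \<beta>) \<and>
      map (type_of \<tau>) (t # ts) = map Some \<alpha>s)"
    by (metis list.map_disc_iff list.distinct(1) list.exhaust)
  finally show ?case .
qed

text \<open>Lets an argument inherit \<open>eta_long\<close>: the subterms tested for
  \<open>u\<close> are among those tested for \<open>t\<close>.\<close>

lemma nonfun_subterms_args:
  "u \<in> set (args t) \<Longrightarrow> insert u (nonfun_subterms u) \<subseteq> nonfun_subterms t"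
  by (induction t) auto

lemma beta_normal_args: "beta_normal t \<Longrightarrow> u \<in> set (args t) \<Longrightarrow> beta_normal u"
  by (induction t) auto

lemma Lam_in_terms: "Lam x s \<in> terms \<tau> \<Longrightarrow> s \<in> terms \<tau>"
  by (auto simp: terms_def well_typed_def eta_long_def split: option.splits)

lemma args_in_terms:
  assumes "apps (Atom a) ts \<in> terms \<tau>" "u \<in> set ts"
  shows "u \<in> terms \<tau>"
proof -
  let ?t = "apps (Atom a) ts"
  have arg: "u \<in> set (args ?t)" using assms(2) by simp
  obtain \<beta> where "type_of \<tau> ?t = Some \<beta>"
    using assms(1) by (auto simp: terms_def well_typed_def)
  then obtain \<alpha>s where "map (type_of \<tau>) ts = map Some \<alpha>s"
    by (auto simp: type_of_apps_eq_Some)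
  then have "type_of \<tau> u \<in> set (map Some \<alpha>s)"
    using assms(2) by (metis image_eqI list.set_map)
  then have "well_typed \<tau> u" by (auto simp: well_typed_def)
  moreover have "beta_normal u"
    using assms(1) beta_normal_args[OF _ arg] by (simp add: terms_def)
  moreover have "eta_long \<tau> u"
    using assms(1) nonfun_subterms_args[OF arg] by (auto simp: terms_def eta_long_def)
  ultimately show ?thesis by (simp add: terms_def)
qed

text \<open>The list \<open>us\<close> stands for the arguments after filtering. Since the result is
  \<open>Base b\<close>, the list \<open>\<alpha>s\<close> is all of
  \<open>arg_types (\<tau> a)\<close>, so the bounds in \<open>arg_filtering\<close> are bounds on
  positions in \<open>us\<close>.\<close>

lemma type_of_filter_apps:
  assumes \<pi>: "arg_filtering \<tau> \<pi>"
    and a: "\<tau> a = arrows \<alpha>s (Base b)"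
    and us: "map (type_of (filter_typing \<tau> \<pi>)) us = map Some \<alpha>s"
  shows "type_of (filter_typing \<tau> \<pi>) (filter_apps \<pi> a us) = Some (Base b)"
proof (cases a)
  case (Var x)
  then show ?thesis using a us by (auto simp: type_of_apps_eq_Some)
next
  case (Sym f)
  have len: "length us = length \<alpha>s" using us by (metis length_map)
  have nth: "type_of (filter_typing \<tau> \<pi>) (us ! (i - 1)) = Some (\<alpha>s ! (i - 1))"
    if "1 \<le> i" "i \<le> length \<alpha>s" for i
  proof -
    have "i - 1 < length \<alpha>s" using that by simp
    then show ?thesis using us len by (metis nth_map)
  qed
  show ?thesis
  proof (cases "\<pi> f")
    case (Collapse i)
    then have "1 \<le> i" "i \<le> length \<alpha>s" "\<alpha>s ! (i - 1) = Base b"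
      using \<pi> a Sym unfolding arg_filtering_def Let_def
      by (auto dest!: spec[of _ f])
    then show ?thesis using nth[of i] Sym Collapse by simp
  next
    case (Select "is")
    then have "\<forall>i \<in> set is. 1 \<le> i \<and> i \<le> length \<alpha>s"
      using \<pi> a Sym unfolding arg_filtering_def Let_def
      by (auto dest!: spec[of _ f])
    then have "map (type_of (filter_typing \<tau> \<pi>)) (map (\<lambda>i. us ! (i - 1)) is) =
        map Some (map (\<lambda>i. \<alpha>s ! (i - 1)) is)"
      using nth by simp
    moreover have "filter_typing \<tau> \<pi> (Sym f) = arrows (map (\<lambda>i. \<alpha>s ! (i - 1)) is) (Base b)"
      using a Sym Select by simp
    ultimately have "type_of (filter_typing \<tau> \<pi>)
        (apps (Atom (Sym f)) (map (\<lambda>i. us ! (i - 1)) is)) = Some (Base b)"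
      unfolding type_of_apps_eq_Some type_of.simps by blast
    then show ?thesis using Sym Select by simp
  qed
qed

lemma type_of_filter_trm:
  assumes \<pi>: "arg_filtering \<tau> \<pi>" and "t \<in> terms \<tau>"
  shows "type_of (filter_typing \<tau> \<pi>) (filter_trm \<pi> t) = type_of \<tau> t"
  using assms(2)
\<comment> \<open>Structural induction would not do: the function part of an \<open>App\<close> in
  \<open>terms \<tau>\<close> has an arrow type without being an abstraction, so it is not in
  \<open>terms \<tau>\<close>. Size induction reaches all the arguments at once.\<close>
proof (induction t rule: measure_induct_rule[of size])
  case (less t)
  obtain xs a ts where t: "t = lams xs (apps (Atom a) ts)"
    using less.prems beta_normal_form[of t] by (auto simp: terms_def)
  show ?case
  proof (cases xs)
    case (Cons x ys)
    then have Lam: "t = Lam x (lams ys (apps (Atom a) ts))" (is "t = Lam x ?s")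
      using t by (simp add: lams_def)
    have "type_of (filter_typing \<tau> \<pi>) (filter_trm \<pi> ?s) = type_of \<tau> ?s"
      using less.IH[of ?s] less.prems Lam_in_terms Lam by fastforce
    moreover have "filter_trm \<pi> t = Lam x (filter_trm \<pi> ?s)"
      unfolding Lam by (simp add: filter_trm.simps[of _ "Lam _ _"])
    ultimately show ?thesis unfolding Lam by (simp split: option.split)
  next
    case Nil
    then have apps: "t = apps (Atom a) ts" using t by (simp add: lams_def)
    then have "\<not> is_abs t" by simp
    \<comment> \<open>\<open>eta_long\<close> also tests \<open>t\<close> itself, not only its
      proper subterms.\<close>
    then obtain b where b: "type_of \<tau> t = Some (Base b)"
      using less.prems by (auto simp: terms_def eta_long_def)
    then obtain \<alpha>s where \<alpha>s: "\<tau> a = arrows \<alpha>s (Base b)" "map (type_of \<tau>) ts = map Some \<alpha>s"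
      unfolding apps type_of_apps_eq_Some by auto
    have "type_of (filter_typing \<tau> \<pi>) (filter_trm \<pi> u) = type_of \<tau> u" if "u \<in> set ts" for u
      using less.IH[of u] args_in_terms[of a ts \<tau> u] size_args[of u t] less.prems that apps by simp
    then have "map (type_of (filter_typing \<tau> \<pi>)) (map (filter_trm \<pi>) ts) = map Some \<alpha>s"
      unfolding \<alpha>s(2)[symmetric] by simp
    from type_of_filter_apps[OF \<pi> \<alpha>s(1) this] show ?thesis
      unfolding b using t Nil by (simp only: filter_trm_lams_apps) (simp add: lams_def)
  qed
qed

theorem theorem1:
  fixes \<tau> :: "('f, 'v, 'b) typing"
    and \<pi> :: "'f \<Rightarrow> filter_spec"
    and t :: "('f, 'v) trm"
  assumes "arg_filtering \<tau> \<pi>"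
    and "t \<in> terms \<tau>"
  shows "well_typed (filter_typing \<tau> \<pi>) (filter_trm \<pi> t) \<and>
         type_of (filter_typing \<tau> \<pi>) (filter_trm \<pi> t) = type_of \<tau> t"
  \<comment> \<open>The equation of options also gives well-typedness, as
    \<open>type_of \<tau> t\<close> is not \<open>None\<close>.\<close>
  using assms type_of_filter_trm[OF assms] by (simp add: terms_def well_typed_def)

end
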